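(* Suppose that for every cyclic matrix $A$ and every complex polynomial $p$ one has $$\|p(\mathcal{D}_{A,v})\|_{E_{A,v}}\le 2\sup_{z\in W(\mathcal{D}_{A,v})}|p(z)|$$ for some $v$ which is cyclic for $A^*$. Then Crouzeix's conjecture holds, i.e. for all square complex matrices $M$ and all complex polynomials $p$, $\|p(M)\|\le 2\sup_{z\in W(M)}|p(z)|$.
   Context: All matrices are square with complex entries, $\|\cdot\|$ is the operator norm induced by the Euclidean norm, and $W(M)=\{\langle Mx,x\rangle:\langle x,x\rangle=1\}$ is the numerical range; the same definition is used for a linear operator on a finite-dimensional Hilbert space. A vector $y\in\mathbb{C}^n$ is cyclic for an $n\times n$ matrix $A$ if $\operatorname{span}\{y,Ay,A^2y,\ldots\}=\mathbb{C}^n$, and $A$ is cyclic if there is a vector cyclic for $A$. If $A$ is cyclic then so is its adjoint $A^*$. For a cyclic $n\times n$ matrix $A$ and a vector $v$ cyclic for $A^*$, define for each $u\in\mathbb{C}^n$ the entire function $\tilde u(z):=\langle e^{zA}u,v\rangle$. Let $E_{A,v}:=\{\tilde u:u\in\mathbb{C}^n\}$ with the (Hilbert space) norm $\|\tilde u\|_{E_{A,v}}=\|u\|_{\mathbb{C}^n}$ (i.e. the inner product transported from $\mathbb{C}^n$ via $u\mapsto\tilde u$), and let $\mathcal{D}_{A,v}:E_{A,v}\to E_{A,v}$ be the differentiation operator, given explicitly by $(\mathcal{D}_{A,v}\tilde u)(z)=\langle e^{zA}Au,v\rangle$. The notation $\|p(\mathcal{D}_{A,v})\|_{E_{A,v}}$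 is the operator norm on $E_{A,v}$. *)

theory Defs
  imports "HOL-Analysis.Derivative" "Jordan_Normal_Form.Schur_Decomposition"
begin

text \<open>
  Operators are functions \<open>T\<close> on a carrier set \<open>S\<close> equipped with an inner product \<open>ip\<close>
  (linear in the first argument), so that the same numerical range and operator norm serve both
  \<open>carrier_vec n\<close> with \<open>(\<bullet>c)\<close> and spaces of functions.
  The supremum is over the unit sphere: it is the operator norm if \<open>S\<close> is nonzero and
  finite-dimensional.
\<close>

definition numerical_range :: "'a set \<Rightarrow> ('a \<Rightarrow> 'a \<Rightarrow> complex) \<Rightarrow> ('a \<Rightarrow> 'a) \<Rightarrow> complex set" where
  "numerical_range S ip T = {ip (T x) x | x. x \<in> S \<and> ip x x = 1}"

definition op_norm :: "'a set \<Rightarrow> ('a \<Rightarrow> 'a \<Rightarrow> complex) \<Rightarrow> ('a \<Rightarrow> 'a) \<Rightarrow> real" where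
  "op_norm S ip T = (SUP x\<in>{x \<in> S. ip x x = 1}. sqrt (Re (ip (T x) (T x))))"

definition mat_range :: "complex mat \<Rightarrow> complex set" where
  "mat_range M = numerical_range (carrier_vec (dim_row M)) (\<bullet>c) ((*\<^sub>v) M)"

definition mat_norm :: "complex mat \<Rightarrow> real" where
  "mat_norm M = op_norm (carrier_vec (dim_row M)) (\<bullet>c) ((*\<^sub>v) M)"

definition mat_poly :: "complex poly \<Rightarrow> complex mat \<Rightarrow> complex mat" where
  "mat_poly p M = mat (dim_row M) (dim_row M)
     (\<lambda>(i, j). \<Sum>k\<le>degree p. coeff p k * (M ^\<^sub>m k) $$ (i, j))"

definition mat_exp :: "complex mat \<Rightarrow> complex mat" where
  "mat_exp M = mat (dim_row M) (dim_row M) (\<lambda>(i, j). \<Sum>k. (M ^\<^sub>m k) $$ (i, j) / fact k)"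

definition cyclic_vector :: "complex mat \<Rightarrow> complex vec \<Rightarrow> bool" where
  "cyclic_vector A y \<longleftrightarrow> y \<in> carrier_vec (dim_row A) \<and>
     LinearCombinations.module.span class_ring (module_vec TYPE(complex) (dim_row A))
       {(A ^\<^sub>m k) *\<^sub>v y | k. True} = carrier_vec (dim_row A)"

definition cyclic_matrix :: "complex mat \<Rightarrow> bool" where
  "cyclic_matrix A \<longleftrightarrow> (\<exists>y. cyclic_vector A y)"

definition tilde :: "complex mat \<Rightarrow> complex vec \<Rightarrow> complex vec \<Rightarrow> complex \<Rightarrow> complex" where
  "tilde A v u = (\<lambda>z. (mat_exp (z \<cdot>\<^sub>m A) *\<^sub>v u) \<bullet>c v)"

definition E_space :: "complex mat \<Rightarrow> complex vec \<Rightarrow> (complex \<Rightarrow> complex) set" where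
  "E_space A v = tilde A v ` carrier_vec (dim_row A)"

text \<open>
  The inner product transported along \<open>tilde A v\<close>, which is injective on \<open>carrier_vec (dim_row A)\<close>
  when \<open>v\<close> is cyclic for the adjoint of \<open>A\<close>; for other \<open>v\<close> it has no meaning.
\<close>

definition E_inner ::
  "complex mat \<Rightarrow> complex vec \<Rightarrow> (complex \<Rightarrow> complex) \<Rightarrow> (complex \<Rightarrow> complex) \<Rightarrow> complex" where
  "E_inner A v f g =
     inv_into (carrier_vec (dim_row A)) (tilde A v) f \<bullet>c
     inv_into (carrier_vec (dim_row A)) (tilde A v) g"

definition fun_op_poly ::
  "complex poly \<Rightarrow> ((complex \<Rightarrow> complex) \<Rightarrow> (complex \<Rightarrow> complex)) \<Rightarrow> (complex \<Rightarrow> complex) \<Rightarrow> (complex \<Rightarrow> complex)" where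
  "fun_op_poly p T f = (\<lambda>z. \<Sum>k\<le>degree p. coeff p k * (T ^^ k) f z)"

text \<open>
  The differentiation operator on \<open>E_space A v\<close> is the restriction of \<open>deriv\<close>.
\<close>

definition E_range :: "complex mat \<Rightarrow> complex vec \<Rightarrow> complex set" where
  "E_range A v = numerical_range (E_space A v) (E_inner A v) deriv"

definition E_poly_norm :: "complex mat \<Rightarrow> complex vec \<Rightarrow> complex poly \<Rightarrow> real" where
  "E_poly_norm A v p = op_norm (E_space A v) (E_inner A v) (fun_op_poly p deriv)"

end

theory Submission
  imports Defs
begin

text \<open>
  If \<open>v\<close> is cyclic for the adjoint of \<open>A\<close>, then \<open>tilde A v\<close> is injective and carries \<open>A\<close> to
  differentiation, so the hypothesis is Crouzeix's inequality for cyclic matrices. Every matrix is a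
  limit of cyclic ones, and the inequality passes to the limit: the norm of \<open>p(M) x\<close> depends
  continuously on \<open>M\<close> for each fixed unit vector \<open>x\<close>, while numerical ranges of nearby matrices are
  close and \<open>p\<close> is uniformly continuous on bounded sets.
\<close>

unbundle no vec_syntax and no inner_syntax

section \<open>Coordinate formulas for products, inner products and powers\<close>

lemma mult_mat_vec_index_sum:
  assumes "B \<in> carrier_mat n n" "u \<in> carrier_vec n" "i < n"
  shows "(B *\<^sub>v u) $ i = (\<Sum>j<n. B $$ (i, j) * u $ j)"
  using assms by (auto simp: scalar_prod_def atLeast0LessThan intro!: sum.cong)

lemma cscalar_prod_sum:
  fixes u v :: "complex vec"
  assumes "v \<in> carrier_vec n"
  shows "u \<bullet>c v = (\<Sum>i<n. u $ i * cnj (v $ i))"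
  using assms by (auto simp: scalar_prod_def atLeast0LessThan intro!: sum.cong)

lemma cscalar_prod_self:
  fixes x :: "complex vec"
  assumes "x \<in> carrier_vec n"
  shows "x \<bullet>c x = of_real (\<Sum>i<n. (cmod (x $ i))\<^sup>2)"
  by (simp only: cscalar_prod_sum[OF assms] complex_norm_square of_real_sum)

lemma sesquilinear_form_sum:
  fixes B :: "complex mat"
  assumes "B \<in> carrier_mat n n" "u \<in> carrier_vec n" "v \<in> carrier_vec n"
  shows "(B *\<^sub>v u) \<bullet>c v = (\<Sum>i<n. \<Sum>j<n. B $$ (i, j) * u $ j * cnj (v $ i))"
  by (simp add: cscalar_prod_sum[OF assms(3)] mult_mat_vec_index_sum[OF assms(1,2)] sum_distrib_right)

lemma pow_mat_Suc_mult_vec: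
  assumes "A \<in> carrier_mat n n" "u \<in> carrier_vec n"
  shows "(A ^\<^sub>m Suc k) *\<^sub>v u = (A ^\<^sub>m k) *\<^sub>v (A *\<^sub>v u)"
  using assms by (simp add: assoc_mult_mat_vec[of _ n n _ n])

text \<open>\<open>A\<close> commutes with its powers. The recursion of the matrix power puts the
  new factor on the right, whereas iterating \<open>deriv\<close> applies the last factor on the
  left, so both forms occur below.\<close>

lemma pow_mat_Suc_mult_vec':
  assumes "A \<in> carrier_mat n n" "u \<in> carrier_vec n"
  shows "(A ^\<^sub>m Suc k) *\<^sub>v u = A *\<^sub>v ((A ^\<^sub>m k) *\<^sub>v u)"
  using assms(2)
proof (induction k arbitrary: u)
  case 0
  then show ?case using assms(1) by simp
next
  case (Suc k)
  have "A *\<^sub>v u \<in> carrier_vec n" using assms(1) Suc.prems by simp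
  with Suc show ?case
    by (simp only: pow_mat_Suc_mult_vec[OF assms(1)])
qed

lemma smult_pow_mat_index:
  fixes A :: "'a :: comm_semiring_1 mat"
  assumes A: "A \<in> carrier_mat n n" and "i < n" "j < n"
  shows "((z \<cdot>\<^sub>m A) ^\<^sub>m k) $$ (i, j) = z ^ k * (A ^\<^sub>m k) $$ (i, j)"
  using assms(2,3)
proof (induction k arbitrary: i j)
  case 0
  then show ?case using A by simp
next
  case (Suc k)
  have "((z \<cdot>\<^sub>m A) ^\<^sub>m Suc k) $$ (i, j) =
      (\<Sum>l = 0..<n. ((z \<cdot>\<^sub>m A) ^\<^sub>m k) $$ (i, l) * (z * A $$ (l, j)))"
    using A Suc.prems by (auto simp: scalar_prod_def intro!: sum.cong)
  also have "\<dots> = (\<Sum>l = 0..<n. z ^ Suc k * ((A ^\<^sub>m k) $$ (i, l) * A $$ (l, j)))"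
    by (rule sum.cong) (use Suc in \<open>auto simp: mult_ac\<close>)
  also have "\<dots> = z ^ Suc k * (A ^\<^sub>m Suc k) $$ (i, j)"
    using A Suc.prems by (auto simp: scalar_prod_def sum_distrib_left intro!: sum.cong)
  finally show ?case .
qed

section \<open>Entrywise bounds and convergence of the exponential series\<close>

text \<open>The entrywise 1-norm: a crude but explicit bound for row sums, column sums, entries of
  powers and points of the numerical range, available without any supremum.\<close>

definition entry_sum :: "complex mat \<Rightarrow> real" where
  "entry_sum A = (\<Sum>i<dim_row A. \<Sum>j<dim_col A. cmod (A $$ (i, j)))"

lemma entry_sum_nonneg: "0 \<le> entry_sum A"
  unfolding entry_sum_def by (intro sum_nonneg) auto

lemma row_sum_le_entry_sum:
  assumes "A \<in> carrier_mat n n" "i < n"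
  shows "(\<Sum>j<n. cmod (A $$ (i, j))) \<le> entry_sum A"
  using assms member_le_sum[of i "{..<n}" "\<lambda>i. \<Sum>j<n. cmod (A $$ (i, j))"]
  by (auto simp: entry_sum_def sum_nonneg)

text \<open>An entry of the next power combines entries of the previous one with the weights in
  column \<open>j\<close> of \<open>A\<close>, and these weights have total modulus at most
  \<open>entry_sum A\<close>.\<close>

lemma pow_mat_index_le:
  fixes A :: "complex mat"
  assumes A: "A \<in> carrier_mat n n" and "i < n" "j < n"
  shows "cmod ((A ^\<^sub>m k) $$ (i, j)) \<le> entry_sum A ^ k"
  using assms(2,3)
proof (induction k arbitrary: i j)
  case 0
  then show ?case using A by simp
next
  case (Suc k)
  have "cmod (A $$ (l, j)) \<le> (\<Sum>j<n. cmod (A $$ (l, j)))" for l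
    using Suc.prems by (intro member_le_sum) auto
  then have col: "(\<Sum>l<n. cmod (A $$ (l, j))) \<le> entry_sum A"
    using A by (auto simp: entry_sum_def intro!: sum_mono)
  have "(A ^\<^sub>m Suc k) $$ (i, j) = (\<Sum>l<n. (A ^\<^sub>m k) $$ (i, l) * A $$ (l, j))"
    using A Suc.prems by (auto simp: scalar_prod_def atLeast0LessThan intro!: sum.cong)
  also have "cmod \<dots> \<le> (\<Sum>l<n. entry_sum A ^ k * cmod (A $$ (l, j)))"
    by (rule order_trans[OF norm_sum sum_mono])
       (use Suc in \<open>auto simp: norm_mult intro!: mult_right_mono\<close>)
  also have "\<dots> \<le> entry_sum A ^ k * entry_sum A"
    using col by (simp add: sum_distrib_left[symmetric] mult_left_mono entry_sum_nonneg)
  finally show ?case by (simp add: mult.commute)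
qed

text \<open>The exponential series of the real number \<open>entry_sum A\<close> dominates each
  entry.\<close>

lemma summable_pow_mat_index:
  fixes A :: "complex mat"
  assumes "A \<in> carrier_mat n n" "i < n" "j < n"
  shows "summable (\<lambda>k. (A ^\<^sub>m k) $$ (i, j) / fact k)"
proof (rule summable_comparison_test'[OF summable_exp])
  fix k
  show "norm ((A ^\<^sub>m k) $$ (i, j) / fact k) \<le> inverse (fact k) * entry_sum A ^ k"
    using pow_mat_index_le[OF assms, of k]
    by (simp add: norm_divide field_simps)
qed

section \<open>The functions \<open>tilde A v u\<close> as power series\<close>

text \<open>The finite sums over \<open>i\<close> and \<open>j\<close> can be taken inside the
  entrywise series of \<open>mat_exp\<close>. The Taylor coefficients at 0 become visible, from
  which derivatives and the value at 0 are read off.\<close>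

lemma tilde_sums:
  assumes A: "A \<in> carrier_mat n n" and u: "u \<in> carrier_vec n" and v: "v \<in> carrier_vec n"
  shows "(\<lambda>k. ((A ^\<^sub>m k) *\<^sub>v u) \<bullet>c v / fact k * z ^ k) sums tilde A v u z"
proof -
  have zA: "z \<cdot>\<^sub>m A \<in> carrier_mat n n" using A by simp
  have "(\<lambda>k. ((z \<cdot>\<^sub>m A) ^\<^sub>m k) $$ (i, j) / fact k) sums mat_exp (z \<cdot>\<^sub>m A) $$ (i, j)"
    if "i < n" "j < n" for i j
    using summable_sums[OF summable_pow_mat_index[OF zA that]] A that by (simp add: mat_exp_def)
  then have "(\<lambda>k. \<Sum>i<n. \<Sum>j<n. ((z \<cdot>\<^sub>m A) ^\<^sub>m k) $$ (i, j) / fact k * u $ j * cnj (v $ i)) sums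
      (\<Sum>i<n. \<Sum>j<n. mat_exp (z \<cdot>\<^sub>m A) $$ (i, j) * u $ j * cnj (v $ i))"
    by (intro sums_sum sums_mult2) auto
  moreover have "mat_exp (z \<cdot>\<^sub>m A) \<in> carrier_mat n n"
    using A by (simp add: mat_exp_def)
  then have "tilde A v u z = (\<Sum>i<n. \<Sum>j<n. mat_exp (z \<cdot>\<^sub>m A) $$ (i, j) * u $ j * cnj (v $ i))"
    unfolding tilde_def using sesquilinear_form_sum u v by blast
  moreover have "(\<Sum>i<n. \<Sum>j<n. ((z \<cdot>\<^sub>m A) ^\<^sub>m k) $$ (i, j) / fact k * u $ j * cnj (v $ i)) =
      ((A ^\<^sub>m k) *\<^sub>v u) \<bullet>c v / fact k * z ^ k" for k
    unfolding sesquilinear_form_sum[OF pow_carrier_mat[OF A] u v]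
    by (auto simp: smult_pow_mat_index[OF A] sum_divide_distrib sum_distrib_right intro!: sum.cong)
  ultimately show ?thesis by simp
qed

lemma tilde_has_field_derivative:
  assumes A: "A \<in> carrier_mat n n" and u: "u \<in> carrier_vec n" and v: "v \<in> carrier_vec n"
  shows "(tilde A v u has_field_derivative tilde A v (A *\<^sub>v u) z) (at z)"
proof -
  define c where "c k = ((A ^\<^sub>m k) *\<^sub>v u) \<bullet>c v / fact k" for k
  have Au: "A *\<^sub>v u \<in> carrier_vec n" using A u by simp
  have sums: "(\<lambda>k. c k * z ^ k) sums tilde A v u z" for z
    unfolding c_def by (rule tilde_sums[OF A u v])
  \<comment> \<open>The factor \<open>Suc k\<close> from differentiation cancels against
    \<open>fact (Suc k)\<close>, and the spare factor \<open>A\<close> moves onto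
    \<open>u\<close>.\<close>
  have "diffs c k = ((A ^\<^sub>m k) *\<^sub>v (A *\<^sub>v u)) \<bullet>c v / fact k" for k
    unfolding diffs_def c_def pow_mat_Suc_mult_vec[OF A u]
    by (simp add: divide_simps del: of_nat_Suc)
  then have d: "(\<lambda>k. diffs c k * z ^ k) sums tilde A v (A *\<^sub>v u) z"
    using tilde_sums[OF A Au v] by simp
  have "((\<lambda>z. \<Sum>k. c k * z ^ k) has_field_derivative (\<Sum>k. diffs c k * z ^ k)) (at z)"
    by (rule termdiffs_strong_converges_everywhere) (use sums sums_summable in blast)
  moreover have "(\<lambda>z. \<Sum>k. c k * z ^ k) = tilde A v u"
    using sums by (simp add: sums_iff)
  ultimately show ?thesis using d by (simp add: sums_iff)
qed

lemma deriv_tilde: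
  assumes "A \<in> carrier_mat n n" "u \<in> carrier_vec n" "v \<in> carrier_vec n"
  shows "deriv (tilde A v u) = tilde A v (A *\<^sub>v u)"
  using tilde_has_field_derivative[OF assms] DERIV_imp_deriv by blast

lemma deriv_pow_tilde:
  assumes A: "A \<in> carrier_mat n n" and u: "u \<in> carrier_vec n" and v: "v \<in> carrier_vec n"
  shows "(deriv ^^ k) (tilde A v u) = tilde A v ((A ^\<^sub>m k) *\<^sub>v u)"
proof (induction k)
  case 0
  then show ?case using A u by simp
next
  case (Suc k)
  have "(A ^\<^sub>m k) *\<^sub>v u \<in> carrier_vec n"
    using mult_mat_vec_carrier[OF pow_carrier_mat[OF A] u] .
  then show ?case
    using Suc deriv_tilde[OF A _ v] pow_mat_Suc_mult_vec'[OF A u, of k] by simp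
qed

lemma tilde_zero:
  assumes A: "A \<in> carrier_mat n n" and u: "u \<in> carrier_vec n" and v: "v \<in> carrier_vec n"
  shows "tilde A v u 0 = u \<bullet>c v"
proof -
  have "(\<lambda>k. ((A ^\<^sub>m k) *\<^sub>v u) \<bullet>c v / fact k * 0 ^ k) sums (u \<bullet>c v)"
    using powser_sums_zero[of "\<lambda>k. ((A ^\<^sub>m k) *\<^sub>v u) \<bullet>c v / fact k"] A u by simp
  then show ?thesis using tilde_sums[OF assms] sums_unique2 by blast
qed

section \<open>Adjoints, and injectivity of \<open>tilde A v\<close> for cyclic
  \<open>v\<close>\<close>

lemma mat_adjoint_index:
  fixes A :: "complex mat"
  assumes "A \<in> carrier_mat n n" "i < n" "j < n"
  shows "mat_adjoint A $$ (i, j) = cnj (A $$ (j, i))"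
  using assms unfolding mat_adjoint_def by (simp add: mat_of_rows_index)

lemma mat_adjoint_carrier:
  assumes "A \<in> carrier_mat n n"
  shows "mat_adjoint A \<in> carrier_mat n n"
  using assms unfolding mat_adjoint_def by auto

lemma cscalar_prod_mat_adjoint:
  fixes A :: "complex mat"
  assumes A: "A \<in> carrier_mat n n" and u: "u \<in> carrier_vec n" and v: "v \<in> carrier_vec n"
  shows "(A *\<^sub>v u) \<bullet>c v = u \<bullet>c (mat_adjoint A *\<^sub>v v)"
proof -
  have "u \<bullet>c (mat_adjoint A *\<^sub>v v) = (\<Sum>j<n. u $ j * cnj ((mat_adjoint A *\<^sub>v v) $ j))"
    by (rule cscalar_prod_sum) (use mult_mat_vec_carrier mat_adjoint_carrier A v in blast)
  also have "\<dots> = (\<Sum>j<n. \<Sum>i<n. A $$ (i, j) * u $ j * cnj (v $ i))"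
    by (intro sum.cong refl)
       (auto simp: mult_mat_vec_index_sum[OF mat_adjoint_carrier[OF A] v]
         mat_adjoint_index[OF A] sum_distrib_left intro!: sum.cong)
  finally show ?thesis
    unfolding sesquilinear_form_sum[OF A u v] by (subst sum.swap) simp
qed

lemma cscalar_prod_pow_mat_adjoint:
  fixes A :: "complex mat"
  assumes A: "A \<in> carrier_mat n n" and u: "u \<in> carrier_vec n" and v: "v \<in> carrier_vec n"
  shows "((A ^\<^sub>m k) *\<^sub>v u) \<bullet>c v = u \<bullet>c ((mat_adjoint A ^\<^sub>m k) *\<^sub>v v)"
  using v
proof (induction k arbitrary: v)
  case 0
  then show ?case using A u mat_adjoint_carrier[OF A] by simp
next
  case (Suc k)
  note A' = mat_adjoint_carrier[OF A]
  have "((A ^\<^sub>m Suc k) *\<^sub>v u) \<bullet>c v = (A *\<^sub>v ((A ^\<^sub>m k) *\<^sub>v u)) \<bullet>c v"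
    by (simp only: pow_mat_Suc_mult_vec'[OF A u])
  also have "\<dots> = ((A ^\<^sub>m k) *\<^sub>v u) \<bullet>c (mat_adjoint A *\<^sub>v v)"
    by (rule cscalar_prod_mat_adjoint[OF A mult_mat_vec_carrier[OF pow_carrier_mat[OF A] u] Suc.prems])
  also have "\<dots> = u \<bullet>c ((mat_adjoint A ^\<^sub>m k) *\<^sub>v (mat_adjoint A *\<^sub>v v))"
    by (rule Suc.IH[OF mult_mat_vec_carrier[OF A' Suc.prems]])
  finally show ?case by (simp only: pow_mat_Suc_mult_vec[OF A' Suc.prems])
qed

text \<open>\<open>orthogonal_complement\<close> refers to the bilinear product without conjugation,
  so it is \<open>conjugate d\<close> that lies in the complement of \<open>S\<close>, hence in that
  of its span. As the span contains \<open>d\<close> itself, \<open>d \<bullet>c d\<close>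
  vanishes.\<close>

lemma orthogonal_span_eq_0:
  fixes d :: "complex vec"
  assumes S: "S \<subseteq> carrier_vec n" and d: "d \<in> carrier_vec n"
    and span: "LinearCombinations.module.span class_ring (module_vec TYPE(complex) n) S = carrier_vec n"
    and orth: "\<And>y. y \<in> S \<Longrightarrow> d \<bullet>c y = 0"
  shows "d = 0\<^sub>v n"
proof -
  interpret vec_space "TYPE(complex)" n .
  have "conjugate d \<bullet> y = 0" if "y \<in> S" for y
  proof -
    have y: "y \<in> carrier_vec n" using S that by auto
    have "conjugate (conjugate d \<bullet> y) = d \<bullet>c y"
      by (rule conjugate_conjugate_sprod[OF d y])
    then show ?thesis using orth[OF that] by (simp only: conjugate_zero_iff)
  qed
  then have "conjugate d \<in> orthogonal_complement S"
    using d unfolding orthogonal_complement_def by simp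
  then have "conjugate d \<in> orthogonal_complement (span S)"
    by (simp only: in_orthogonal_complement_span[OF S])
  then have "conjugate d \<bullet> d = 0"
    using d span unfolding orthogonal_complement_def by auto
  then have "d \<bullet>c d = 0" using conjugate_vec_sprod_comm[OF d d] by simp
  then show ?thesis using d by simp
qed

text \<open>The \<open>k\<close>-th derivative of \<open>tilde A v u\<close> at 0 is the inner
  product of \<open>u\<close> with the \<open>k\<close>-th power of the adjoint applied to
  \<open>v\<close>. Two vectors with the same function therefore differ by a vector orthogonal to
  the whole orbit of \<open>v\<close>, which spans the space.\<close>

lemma inj_on_tilde:
  assumes A: "A \<in> carrier_mat n n" and cyc: "cyclic_vector (mat_adjoint A) v"
  shows "inj_on (tilde A v) (carrier_vec n)"
proof (rule inj_onI)
  fix u w assume u: "u \<in> carrier_vec n" and w: "w \<in> carrier_vec n" and eq: "tilde A v u = tilde A v w"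
  note A' = mat_adjoint_carrier[OF A]
  let ?S = "{(mat_adjoint A ^\<^sub>m k) *\<^sub>v v | k. True}"
  have v: "v \<in> carrier_vec n"
    and span: "LinearCombinations.module.span class_ring (module_vec TYPE(complex) n) ?S = carrier_vec n"
    using cyc A' unfolding cyclic_vector_def by auto
  have S: "?S \<subseteq> carrier_vec n"
    using mult_mat_vec_carrier[OF pow_carrier_mat[OF A'] v] by auto
  have "(u - w) \<bullet>c y = 0" if "y \<in> ?S" for y
  proof -
    obtain k where y: "y = (mat_adjoint A ^\<^sub>m k) *\<^sub>v v" using \<open>y \<in> ?S\<close> by auto
    have yc: "y \<in> carrier_vec n" using S that by auto
    have *: "(deriv ^^ k) (tilde A v x) 0 = x \<bullet>c y" if x: "x \<in> carrier_vec n" for x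
      unfolding deriv_pow_tilde[OF A x v] y cscalar_prod_pow_mat_adjoint[OF A x v, symmetric]
      by (rule tilde_zero[OF A _ v]) (rule mult_mat_vec_carrier[OF pow_carrier_mat[OF A] x])
    have "u \<bullet>c y = w \<bullet>c y" using *[OF u] *[OF w] eq by simp
    moreover have "(u - w) \<bullet>c y = u \<bullet>c y - w \<bullet>c y"
      using u w yc by (simp add: minus_scalar_prod_distrib[of _ n])
    ultimately show ?thesis by simp
  qed
  then have "u - w = 0\<^sub>v n"
    using orthogonal_span_eq_0[OF S _ span] u w by auto
  then show "u = w" using u w by (auto simp: vec_eq_iff)
qed

section \<open>Polynomials of operators and the isometric transport to
  \<open>E_space\<close>\<close>

lemma mat_poly_carrier:
  assumes "A \<in> carrier_mat n n"
  shows "mat_poly p A \<in> carrier_mat n n"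
  using assms by (simp add: mat_poly_def)

lemma mat_poly_mult_vec_index:
  assumes A: "A \<in> carrier_mat n n" and u: "u \<in> carrier_vec n" and i: "i < n"
  shows "(mat_poly p A *\<^sub>v u) $ i = (\<Sum>k\<le>degree p. coeff p k * ((A ^\<^sub>m k) *\<^sub>v u) $ i)"
proof -
  have "(mat_poly p A *\<^sub>v u) $ i = (\<Sum>j<n. \<Sum>k\<le>degree p. coeff p k * (A ^\<^sub>m k) $$ (i, j) * u $ j)"
    unfolding mult_mat_vec_index_sum[OF mat_poly_carrier[OF A] u i]
    by (intro sum.cong refl) (use A i in \<open>simp add: mat_poly_def sum_distrib_right\<close>)
  also have "\<dots> = (\<Sum>k\<le>degree p. coeff p k * (\<Sum>j<n. (A ^\<^sub>m k) $$ (i, j) * u $ j))"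
    by (subst sum.swap) (simp add: sum_distrib_left mult.assoc)
  finally show ?thesis
    by (simp only: mult_mat_vec_index_sum[OF pow_carrier_mat[OF A] u i])
qed

lemma fun_op_poly_tilde:
  assumes A: "A \<in> carrier_mat n n" and u: "u \<in> carrier_vec n" and v: "v \<in> carrier_vec n"
  shows "fun_op_poly p deriv (tilde A v u) = tilde A v (mat_poly p A *\<^sub>v u)"
proof
  fix z
  define E where "E = mat_exp (z \<cdot>\<^sub>m A)"
  \<comment> \<open>For fixed \<open>z\<close> the value \<open>tilde A v x z\<close> is a linear
    functional of \<open>x\<close>; \<open>e\<close> is its coefficient row, so linear combinations
    of vectors pass through it.\<close>
  define e where "e j = (\<Sum>i<n. E $$ (i, j) * cnj (v $ i))" for j
  have E: "E \<in> carrier_mat n n" using A by (simp add: E_def mat_exp_def)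
  have lin: "tilde A v x z = (\<Sum>j<n. e j * x $ j)" if "x \<in> carrier_vec n" for x
    unfolding tilde_def E_def[symmetric] sesquilinear_form_sum[OF E that v] e_def
    by (subst sum.swap) (simp add: sum_distrib_left mult_ac)
  have "fun_op_poly p deriv (tilde A v u) z =
      (\<Sum>k\<le>degree p. coeff p k * (\<Sum>j<n. e j * ((A ^\<^sub>m k) *\<^sub>v u) $ j))"
    unfolding fun_op_poly_def deriv_pow_tilde[OF A u v]
    by (simp only: lin[OF mult_mat_vec_carrier[OF pow_carrier_mat[OF A] u]])
  also have "\<dots> = (\<Sum>j<n. e j * (mat_poly p A *\<^sub>v u) $ j)"
    unfolding sum_distrib_left
    by (subst sum.swap)
       (simp add: mat_poly_mult_vec_index[OF A u] sum_distrib_left mult.left_commute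
         del: index_mult_mat_vec)
  also have "\<dots> = tilde A v (mat_poly p A *\<^sub>v u) z"
    by (rule lin[symmetric]) (rule mult_mat_vec_carrier[OF mat_poly_carrier[OF A] u])
  finally show "fun_op_poly p deriv (tilde A v u) z = tilde A v (mat_poly p A *\<^sub>v u) z" .
qed

lemma E_inner_tilde:
  assumes "A \<in> carrier_mat n n" "inj_on (tilde A v) (carrier_vec n)"
    "u \<in> carrier_vec n" "w \<in> carrier_vec n"
  shows "E_inner A v (tilde A v u) (tilde A v w) = u \<bullet>c w"
  using assms by (simp add: E_inner_def)

text \<open>\<open>tilde A v\<close> is a bijection onto \<open>E_space A v\<close> that preserves
  inner products and intertwines \<open>A\<close> with \<open>deriv\<close>, so the two operators
  are unitarily equivalent.\<close>

lemma E_range_eq_mat_range: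
  assumes A: "A \<in> carrier_mat n n" and v: "v \<in> carrier_vec n"
    and inj: "inj_on (tilde A v) (carrier_vec n)"
  shows "E_range A v = mat_range A"
proof -
  note [simp] = E_inner_tilde[OF A inj] deriv_tilde[OF A _ v] mult_mat_vec_carrier[OF A]
  have *: "dim_row A = n" using A by simp
  show ?thesis
    unfolding E_range_def mat_range_def numerical_range_def E_space_def * by force
qed

text \<open>The unit sphere of \<open>E_space A v\<close> is the image of the unit sphere of
  vectors. Reindexing the supremum along \<open>tilde A v\<close> leaves the same values, since
  \<open>p\<close> of \<open>deriv\<close> corresponds to \<open>mat_poly p A\<close>.\<close>

lemma E_poly_norm_eq_mat_norm:
  assumes A: "A \<in> carrier_mat n n" and v: "v \<in> carrier_vec n"
    and inj: "inj_on (tilde A v) (carrier_vec n)"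
  shows "E_poly_norm A v p = mat_norm (mat_poly p A)"
proof -
  note [simp] = E_inner_tilde[OF A inj] fun_op_poly_tilde[OF A _ v]
    mult_mat_vec_carrier[OF mat_poly_carrier[OF A]]
  have *: "dim_row A = n" "dim_row (mat_poly p A) = n" using A mat_poly_carrier[OF A, of p] by auto
  have "{f \<in> E_space A v. E_inner A v f f = 1} = tilde A v ` {u \<in> carrier_vec n. u \<bullet>c u = 1}"
    unfolding E_space_def * by auto
  then show ?thesis
    unfolding E_poly_norm_def mat_norm_def op_norm_def * by (simp add: image_image cong: image_cong_simp)
qed

section \<open>Krylov determinants and cyclic perturbations\<close>

text \<open>The matrix has columns \<open>y\<close>, \<open>A y\<close>, up to the power
  \<open>n - 1\<close>. If it is invertible, these \<open>n\<close> vectors alone already span the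
  space.\<close>

lemma cyclic_vectorI_det:
  assumes A: "A \<in> carrier_mat n n" and y: "y \<in> carrier_vec n"
    and det: "det (mat n n (\<lambda>(i, k). ((A ^\<^sub>m k) *\<^sub>v y) $ i)) \<noteq> 0"
  shows "cyclic_vector A y"
proof -
  interpret vec_space "TYPE(complex)" n .
  define ws where "ws = map (\<lambda>k. (A ^\<^sub>m k) *\<^sub>v y) [0..<n]"
  define K where "K = mat_of_cols n ws"
  let ?S = "{(A ^\<^sub>m k) *\<^sub>v y | k. True}"
  have S: "?S \<subseteq> carrier_vec n"
    using mult_mat_vec_carrier[OF pow_carrier_mat[OF A] y] by auto
  have ws: "set ws \<subseteq> ?S" "length ws = n" by (auto simp: ws_def)
  have dim_ws: "\<forall>w\<in>set ws. dim_vec w = n" using A by (auto simp: ws_def)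
  have "K = mat n n (\<lambda>(i, k). ((A ^\<^sub>m k) *\<^sub>v y) $ i)"
    unfolding K_def by (rule eq_matI) (auto simp: ws_def mat_of_cols_index simp del: index_mult_mat_vec)
  then have K: "K \<in> carrier_mat n n" "det K \<noteq> 0" using det by simp_all
  have "w \<in> span ?S" if w: "w \<in> carrier_vec n" for w
  proof -
    \<comment> \<open>Cramer's rule: \<open>c\<close> solves \<open>K *\<^sub>v c = w\<close>, so
      its entries are the coefficients of \<open>w\<close> in the columns of
      \<open>K\<close>.\<close>
    define c where "c = (1 / det K) \<cdot>\<^sub>v (adj_mat K *\<^sub>v w)"
    have adj: "adj_mat K \<in> carrier_mat n n" "K * adj_mat K = det K \<cdot>\<^sub>m 1\<^sub>m n"
      using adj_mat[OF K(1)] by auto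
    have c: "c \<in> carrier_vec n" using mult_mat_vec_carrier[OF adj(1) w] by (simp add: c_def)
    have "K *\<^sub>v c = (1 / det K) \<cdot>\<^sub>v ((K * adj_mat K) *\<^sub>v w)"
      unfolding c_def assoc_mult_mat_vec[OF K(1) adj(1) w]
      by (rule mult_mat_vec[OF K(1) mult_mat_vec_carrier[OF adj(1) w]])
    also have "\<dots> = w"
      unfolding adj(2) by (rule eq_vecI) (use w K(2) in \<open>auto simp: row_smult\<close>)
    finally have Kc: "K *\<^sub>v c = w" .
    have "lincomb_list (\<lambda>i. c $ i) ws = K *\<^sub>v vec n (\<lambda>i. c $ i)"
      unfolding K_def lincomb_list_as_mat_mult[OF dim_ws] ws(2) ..
    also have "vec n (\<lambda>i. c $ i) = c" using c by auto
    finally have "w \<in> span_list ws"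
      unfolding span_list_def using Kc by (auto intro!: exI[of _ "\<lambda>i. c $ i"])
    also have "span_list ws = span (set ws)"
      using ws S by (intro span_list_as_span) auto
    finally show ?thesis using span_is_monotone[OF ws(1)] by auto
  qed
  moreover have "span ?S \<subseteq> carrier_vec n" using span_is_subset2[OF S] by simp
  moreover have "dim_row A = n" using A by simp
  ultimately show ?thesis unfolding cyclic_vector_def using y by auto
qed

text \<open>The nilpotent Jordan block with ones below the diagonal. It sends each basis vector to
  the next, so the first one is cyclic.\<close>

definition shift_mat :: "nat \<Rightarrow> complex mat" where
  "shift_mat n = mat n n (\<lambda>(i, j). if i = Suc j then 1 else 0)"

lemma shift_mat_carrier [simp]: "shift_mat n \<in> carrier_mat n n"
  by (simp add: shift_mat_def)

lemma shift_mat_pow_unit_vec: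
  assumes "k < n"
  shows "(shift_mat n ^\<^sub>m k) *\<^sub>v unit_vec n 0 = unit_vec n k"
  using assms
proof (induction k)
  case 0
  then show ?case by (simp add: shift_mat_def)
next
  case (Suc k)
  have "shift_mat n *\<^sub>v unit_vec n k = unit_vec n (Suc k)"
    by (rule eq_vecI) (use Suc.prems in \<open>auto simp: shift_mat_def\<close>)
  with Suc show ?case
    by (simp only: pow_mat_Suc_mult_vec'[OF shift_mat_carrier unit_vec_carrier])
qed

text \<open>
  The Krylov determinant of \<open>M + t D\<close> at \<open>e\<^sub>0\<close> is a polynomial in \<open>t\<close>; with \<open>D = S - M\<close> it does
  not vanish at \<open>t = 1\<close>, where the Krylov matrix of the shift \<open>S\<close> is the identity.
\<close>

lemma eventually_cyclic_perturbation:
  fixes M :: "complex mat"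
  assumes M: "M \<in> carrier_mat n n"
  shows "\<forall>\<^sub>F t in at 0. cyclic_matrix (M + t \<cdot>\<^sub>m (shift_mat n - M))"
proof -
  have ring_hom: "comm_ring_hom (\<lambda>p. poly p t)" for t :: complex ..
  have hom: "semiring_hom (\<lambda>p. poly p t)" for t :: complex ..
  let ?C = "\<lambda>a. [:a:] :: complex poly"
  define D where "D = shift_mat n - M"
  \<comment> \<open>\<open>P\<close> is \<open>M + t D\<close> over the polynomial ring, with
    \<open>t\<close> as the indeterminate. Evaluation at a number is a ring homomorphism, so it
    commutes with powers, products and determinants and turns \<open>P\<close> into
    \<open>F t\<close>.\<close>
  define P where "P = map_mat ?C M + [:0, 1:] \<cdot>\<^sub>m map_mat ?C D"
  define Y where "Y = map_vec ?C (unit_vec n 0)"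
  define Q where "Q = mat n n (\<lambda>(i, k). ((P ^\<^sub>m k) *\<^sub>v Y) $ i)"
  define F where "F t = M + t \<cdot>\<^sub>m D" for t
  have D: "D \<in> carrier_mat n n" unfolding D_def by (rule minus_carrier_mat[OF M])
  have P: "P \<in> carrier_mat n n" using M D by (simp add: P_def)
  have Y: "Y \<in> carrier_vec n" by (simp add: Y_def)
  have F: "F t \<in> carrier_mat n n" for t using M D by (simp add: F_def)
  have PF: "map_mat (\<lambda>p. poly p t) P = F t" for t
    unfolding P_def F_def by (rule eq_matI) (use M D in \<open>auto simp: mult.commute\<close>)
  have YE: "map_vec (\<lambda>p. poly p t) Y = unit_vec n 0" for t
    unfolding Y_def by (rule eq_vecI) auto
  have "map_mat (\<lambda>p. poly p t) Q = mat n n (\<lambda>(i, k). ((F t ^\<^sub>m k) *\<^sub>v unit_vec n 0) $ i)" for t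
  proof (rule eq_matI)
    fix i k assume "i < dim_row (mat n n (\<lambda>(i, k). ((F t ^\<^sub>m k) *\<^sub>v unit_vec n 0) $ i))"
      "k < dim_col (mat n n (\<lambda>(i, k). ((F t ^\<^sub>m k) *\<^sub>v unit_vec n 0) $ i))"
    then have ik: "i < n" "k < n" by auto
    have "map_vec (\<lambda>p. poly p t) ((P ^\<^sub>m k) *\<^sub>v Y) = (F t ^\<^sub>m k) *\<^sub>v unit_vec n 0"
      unfolding semiring_hom.mult_mat_vec_hom[OF hom pow_carrier_mat[OF P] Y] semiring_hom.mat_hom_pow[OF hom P] PF YE ..
    moreover have "i < dim_vec ((P ^\<^sub>m k) *\<^sub>v Y)"
      using ik P by simp
    ultimately have "poly (((P ^\<^sub>m k) *\<^sub>v Y) $ i) t = ((F t ^\<^sub>m k) *\<^sub>v unit_vec n 0) $ i"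
      using index_map_vec(1)[of i "(P ^\<^sub>m k) *\<^sub>v Y" "\<lambda>p. poly p t"] by simp
    then show "map_mat (\<lambda>p. poly p t) Q $$ (i, k) =
        mat n n (\<lambda>(i, k). ((F t ^\<^sub>m k) *\<^sub>v unit_vec n 0) $ i) $$ (i, k)"
      using ik by (simp add: Q_def del: index_mult_mat_vec)
  qed (auto simp: Q_def)
  then have det: "poly (det Q) t = det (mat n n (\<lambda>(i, k). ((F t ^\<^sub>m k) *\<^sub>v unit_vec n 0) $ i))" for t
    using comm_ring_hom.hom_det[OF ring_hom, of t Q] by simp
  have "F 1 = shift_mat n"
    unfolding F_def D_def by (rule eq_matI) (use M in \<open>auto simp: shift_mat_def\<close>)
  then have "mat n n (\<lambda>(i, k). ((F 1 ^\<^sub>m k) *\<^sub>v unit_vec n 0) $ i) = 1\<^sub>m n"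
    by (intro eq_matI) (auto simp: shift_mat_pow_unit_vec simp del: index_mult_mat_vec)
  then have "poly (det Q) 1 = 1" by (simp add: det)
  then have "det Q \<noteq> 0" by auto
  \<comment> \<open>The point 0 may itself be a root, but \<open>at 0\<close> ignores it. The other
    roots form a finite set, whose complement is an open neighbourhood of 0.\<close>
  then have "closed ({t. poly (det Q) t = 0} - {0})"
    by (intro finite_imp_closed finite_Diff poly_roots_finite)
  then have "\<forall>\<^sub>F t in at 0. t \<notin> {t. poly (det Q) t = 0}"
    unfolding eventually_at_topological
    by (intro exI[of _ "- ({t. poly (det Q) t = 0} - {0})"] conjI open_Compl) auto
  then show ?thesis
  proof eventually_elim
    case (elim t)
    then have "cyclic_vector (F t) (unit_vec n 0)"
      using det by (intro cyclic_vectorI_det[OF F unit_vec_carrier]) auto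
    then show ?case unfolding cyclic_matrix_def F_def D_def by blast
  qed
qed

section \<open>Bounds on the unit sphere and well-behaved suprema\<close>

lemma norm_index_le_1:
  fixes x :: "complex vec"
  assumes x: "x \<in> carrier_vec n" and unit: "x \<bullet>c x = 1" and i: "i < n"
  shows "cmod (x $ i) \<le> 1"
proof -
  have "(cmod (x $ i))\<^sup>2 \<le> (\<Sum>i<n. (cmod (x $ i))\<^sup>2)"
    using i by (intro member_le_sum) auto
  also have "\<dots> = 1" using unit unfolding cscalar_prod_self[OF x] by (simp only: of_real_eq_1_iff)
  finally show ?thesis by (simp add: power_le_one_iff)
qed

lemma norm_sesquilinear_form_le:
  fixes B :: "complex mat"
  assumes B: "B \<in> carrier_mat n n" and x: "x \<in> carrier_vec n" and unit: "x \<bullet>c x = 1"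
  shows "cmod ((B *\<^sub>v x) \<bullet>c x) \<le> entry_sum B"
proof -
  have "cmod (B $$ (i, j) * x $ j * cnj (x $ i)) \<le> cmod (B $$ (i, j))" if "i < n" "j < n" for i j
  proof -
    have "cmod (B $$ (i, j)) * cmod (x $ j) * cmod (x $ i) \<le> cmod (B $$ (i, j)) * 1 * 1"
      using norm_index_le_1[OF x unit] that by (intro mult_mono) auto
    then show ?thesis by (simp add: norm_mult)
  qed
  then show ?thesis
    unfolding sesquilinear_form_sum[OF B x x] entry_sum_def
    using B by (intro order_trans[OF norm_sum] sum_mono) (auto intro!: order_trans[OF norm_sum] sum_mono)
qed

text \<open>A real supremum says something about its members only when the set is bounded; this
  justifies \<open>le_mat_norm\<close>.\<close>

lemma bdd_above_op_norm:
  fixes B :: "complex mat"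
  assumes B: "B \<in> carrier_mat n n"
  shows "bdd_above ((\<lambda>x. sqrt (Re ((B *\<^sub>v x) \<bullet>c (B *\<^sub>v x)))) ` {x \<in> carrier_vec n. x \<bullet>c x = 1})"
proof (rule bdd_aboveI2)
  fix x :: "complex vec" assume "x \<in> {x \<in> carrier_vec n. x \<bullet>c x = 1}"
  then have x: "x \<in> carrier_vec n" "x \<bullet>c x = 1" by auto
  have le: "cmod ((B *\<^sub>v x) $ i) \<le> entry_sum B" if i: "i < n" for i
  proof -
    have "cmod ((B *\<^sub>v x) $ i) \<le> (\<Sum>j<n. cmod (B $$ (i, j)) * 1)"
      unfolding mult_mat_vec_index_sum[OF B x(1) i]
      by (rule order_trans[OF norm_sum sum_mono])
         (use norm_index_le_1[OF x] in \<open>auto simp: norm_mult intro!: mult_left_le\<close>)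
    then show ?thesis using row_sum_le_entry_sum[OF B i] by simp
  qed
  have "Re ((B *\<^sub>v x) \<bullet>c (B *\<^sub>v x)) = (\<Sum>i<n. (cmod ((B *\<^sub>v x) $ i))\<^sup>2)"
    unfolding cscalar_prod_self[OF mult_mat_vec_carrier[OF B x(1)]] by simp
  also have "\<dots> \<le> (\<Sum>i<n. (entry_sum B)\<^sup>2)"
    by (intro sum_mono power_mono) (use le in auto)
  finally show "sqrt (Re ((B *\<^sub>v x) \<bullet>c (B *\<^sub>v x))) \<le> sqrt (\<Sum>i<n. (entry_sum B)\<^sup>2)"
    by simp
qed

lemma le_mat_norm:
  fixes B :: "complex mat"
  assumes B: "B \<in> carrier_mat n n" and x: "x \<in> carrier_vec n" and unit: "x \<bullet>c x = 1"
  shows "sqrt (Re ((B *\<^sub>v x) \<bullet>c (B *\<^sub>v x))) \<le> mat_norm B"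
proof -
  have "dim_row B = n" using B by simp
  then show ?thesis
    unfolding mat_norm_def op_norm_def
    using cSUP_upper[OF _ bdd_above_op_norm[OF B], of x] x unit by simp
qed

text \<open>Supplies a point of the unit sphere, so that the suprema over the sphere and over the
  numerical range are not over empty sets.\<close>

lemma unit_vec_unit:
  assumes "n > 0"
  shows "unit_vec n 0 \<bullet>c unit_vec n 0 = (1 :: complex)"
proof -
  have "unit_vec n 0 \<bullet>c unit_vec n 0 =
      (\<Sum>i<n. unit_vec n 0 $ i * cnj (unit_vec n 0 $ i) :: complex)"
    by (rule cscalar_prod_sum) simp
  also have "\<dots> = (\<Sum>i<n. if i = 0 then 1 else 0)"
    by (rule sum.cong) auto
  finally show ?thesis using assms by simp
qed

lemma mat_norm_leI:
  assumes "B \<in> carrier_mat n n" and "n > 0"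
    and "\<And>x. x \<in> carrier_vec n \<Longrightarrow> x \<bullet>c x = 1 \<Longrightarrow> sqrt (Re ((B *\<^sub>v x) \<bullet>c (B *\<^sub>v x))) \<le> c"
  shows "mat_norm B \<le> c"
proof -
  have "dim_row B = n" using assms(1) by simp
  moreover have "{x \<in> carrier_vec n. x \<bullet>c x = (1 :: complex)} \<noteq> {}"
    using unit_vec_unit[OF assms(2)] unit_vec_carrier by blast
  ultimately show ?thesis
    unfolding mat_norm_def op_norm_def using assms(3) by (intro cSUP_least) auto
qed

lemma mat_rangeE:
  assumes "B \<in> carrier_mat n n" "z \<in> mat_range B"
  obtains x :: "complex vec" where "x \<in> carrier_vec n" "x \<bullet>c x = 1" "z = (B *\<^sub>v x) \<bullet>c x"
  using assms unfolding mat_range_def numerical_range_def by auto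

lemma mat_rangeI:
  assumes "B \<in> carrier_mat n n" "x \<in> carrier_vec n" "x \<bullet>c x = 1"
  shows "(B *\<^sub>v x) \<bullet>c x \<in> mat_range B"
  using assms unfolding mat_range_def numerical_range_def by auto

lemma mat_range_nonempty:
  assumes "B \<in> carrier_mat n n" "n > 0"
  shows "mat_range B \<noteq> {}"
  using mat_rangeI[OF assms(1) unit_vec_carrier unit_vec_unit[OF assms(2)]] by blast

text \<open>The numerical range lies in a closed disk, on which the continuous function
  \<open>cmod (poly p z)\<close> is bounded by compactness.\<close>

lemma bdd_above_poly_mat_range:
  assumes B: "B \<in> carrier_mat n n"
  shows "bdd_above ((\<lambda>z. cmod (poly p z)) ` mat_range B)"
proof -
  have "mat_range B \<subseteq> cball 0 (entry_sum B)"
    using norm_sesquilinear_form_le[OF B] by (auto elim!: mat_rangeE[OF B])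
  moreover have "bdd_above ((\<lambda>z. cmod (poly p z)) ` cball 0 (entry_sum B))"
    by (intro bounded_imp_bdd_above compact_imp_bounded compact_continuous_image)
       (auto intro!: continuous_intros)
  ultimately show ?thesis by (meson bdd_above_mono image_mono)
qed

section \<open>Behaviour of both sides of the inequality under perturbation\<close>

lemma tendsto_pow_mat_index:
  fixes F :: "'a \<Rightarrow> complex mat"
  assumes F: "\<And>t. F t \<in> carrier_mat n n" and A: "A \<in> carrier_mat n n"
    and lim: "\<And>i j. i < n \<Longrightarrow> j < n \<Longrightarrow> ((\<lambda>t. F t $$ (i, j)) \<longlongrightarrow> A $$ (i, j)) G"
    and "i < n" "j < n"
  shows "((\<lambda>t. (F t ^\<^sub>m k) $$ (i, j)) \<longlongrightarrow> (A ^\<^sub>m k) $$ (i, j)) G"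
  using assms(4,5)
proof (induction k arbitrary: i j)
  case 0
  have "dim_row (F t) = n" "dim_row A = n" for t using F[of t] A by auto
  with 0 show ?case by simp
next
  case (Suc k)
  have *: "(B ^\<^sub>m Suc k) $$ (i, j) = (\<Sum>l<n. (B ^\<^sub>m k) $$ (i, l) * B $$ (l, j))"
    if "B \<in> carrier_mat n n" for B :: "complex mat"
    using that Suc.prems by (auto simp: scalar_prod_def atLeast0LessThan intro!: sum.cong)
  show ?case
    unfolding *[OF F] *[OF A] by (intro tendsto_intros Suc.IH lim) (use Suc.prems in auto)
qed

text \<open>With \<open>x\<close> fixed, everything is a finite expression in the entries of the
  matrix. Continuity of the supremum \<open>mat_norm\<close> is thereby avoided.\<close>

lemma tendsto_norm_mat_poly_mult_vec:
  fixes F :: "'a \<Rightarrow> complex mat"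
  assumes F: "\<And>t. F t \<in> carrier_mat n n" and A: "A \<in> carrier_mat n n"
    and lim: "\<And>i j. i < n \<Longrightarrow> j < n \<Longrightarrow> ((\<lambda>t. F t $$ (i, j)) \<longlongrightarrow> A $$ (i, j)) G"
    and x: "x \<in> carrier_vec n"
  shows "((\<lambda>t. sqrt (Re ((mat_poly p (F t) *\<^sub>v x) \<bullet>c (mat_poly p (F t) *\<^sub>v x)))) \<longlongrightarrow>
    sqrt (Re ((mat_poly p A *\<^sub>v x) \<bullet>c (mat_poly p A *\<^sub>v x)))) G"
proof -
  have "((\<lambda>t. (mat_poly p (F t) *\<^sub>v x) $ i) \<longlongrightarrow> (mat_poly p A *\<^sub>v x) $ i) G" if i: "i < n" for i
    unfolding mat_poly_mult_vec_index[OF F x i] mat_poly_mult_vec_index[OF A x i]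
      mult_mat_vec_index_sum[OF pow_carrier_mat[OF F] x i]
      mult_mat_vec_index_sum[OF pow_carrier_mat[OF A] x i]
    by (intro tendsto_intros tendsto_pow_mat_index[OF F A lim]) (use i in auto)
  then show ?thesis
    unfolding cscalar_prod_sum[OF mult_mat_vec_carrier[OF mat_poly_carrier[OF F] x]]
      cscalar_prod_sum[OF mult_mat_vec_carrier[OF mat_poly_carrier[OF A] x]]
    by (intro tendsto_intros) auto
qed

text \<open>Upper semicontinuity is enough for the limit argument: each point of the perturbed
  numerical range is compared with the point of \<open>mat_range M\<close> given by the same unit
  vector.\<close>

lemma eventually_sup_mat_range_le:
  fixes M D :: "complex mat"
  assumes M: "M \<in> carrier_mat n n" and D: "D \<in> carrier_mat n n" and n: "n > 0" and \<epsilon>: "\<epsilon> > 0"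
  shows "\<forall>\<^sub>F t in at 0. (SUP z\<in>mat_range (M + t \<cdot>\<^sub>m D). cmod (poly p z)) \<le>
    (SUP z\<in>mat_range M. cmod (poly p z)) + \<epsilon>"
proof -
  \<comment> \<open>For \<open>cmod t < 1\<close> the disk of radius \<open>R\<close> contains the
    numerical ranges of both \<open>M\<close> and \<open>M + t \<cdot>\<^sub>m D\<close>.\<close>
  define R where "R = entry_sum M + entry_sum D"
  have "uniformly_continuous_on (cball 0 R) (poly p)"
    by (intro compact_uniformly_continuous continuous_intros) auto
  then obtain \<delta> where \<delta>: "\<delta> > 0" and close:
    "\<And>z w. z \<in> cball 0 R \<Longrightarrow> w \<in> cball 0 R \<Longrightarrow> dist z w < \<delta> \<Longrightarrow> dist (poly p z) (poly p w) < \<epsilon>"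
    using \<epsilon> unfolding uniformly_continuous_on_def by metis
  have "((\<lambda>t. cmod t * entry_sum D) \<longlongrightarrow> cmod 0 * entry_sum D) (at 0)"
    by (intro tendsto_intros)
  then have small: "\<forall>\<^sub>F t in at 0. cmod t * entry_sum D < \<delta>"
    using \<delta> by (intro order_tendstoD) auto
  have "(\<lambda>t::complex. cmod t) \<midarrow>0\<rightarrow> cmod 0"
    by (intro tendsto_intros)
  then have le1: "\<forall>\<^sub>F t::complex in at 0. cmod t < 1"
    by (intro order_tendstoD) auto
  from small le1 show ?thesis
  proof eventually_elim
    case (elim t)
    have F: "M + t \<cdot>\<^sub>m D \<in> carrier_mat n n" using M D by simp
    show ?case
    proof (rule cSUP_least[OF mat_range_nonempty[OF F n]])
      fix z assume "z \<in> mat_range (M + t \<cdot>\<^sub>m D)"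
      then obtain x where x: "x \<in> carrier_vec n" "x \<bullet>c x = 1" and z: "z = ((M + t \<cdot>\<^sub>m D) *\<^sub>v x) \<bullet>c x"
        by (rule mat_rangeE[OF F])
      \<comment> \<open>The distance from \<open>z\<close> to \<open>w\<close> is
        \<open>cmod (t * d)\<close>, which is small uniformly in \<open>x\<close> because
        \<open>cmod d\<close> is at most \<open>entry_sum D\<close>.\<close>
      define w where "w = (M *\<^sub>v x) \<bullet>c x"
      define d where "d = (D *\<^sub>v x) \<bullet>c x"
      have zwd: "z = w + t * d"
        unfolding z w_def d_def sesquilinear_form_sum[OF F x(1) x(1)]
          sesquilinear_form_sum[OF M x(1) x(1)] sesquilinear_form_sum[OF D x(1) x(1)]
          sum_distrib_left sum.distrib[symmetric]
        by (intro sum.cong refl) (use M D in \<open>auto simp: algebra_simps\<close>)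
      have w: "cmod w \<le> entry_sum M" and d: "cmod d \<le> entry_sum D"
        unfolding w_def d_def using norm_sesquilinear_form_le x M D by blast+
      have "cmod (t * d) \<le> cmod t * entry_sum D"
        using d by (simp add: norm_mult mult_left_mono)
      moreover have "cmod t * entry_sum D \<le> entry_sum D"
        using elim(2) entry_sum_nonneg[of D] by (simp add: mult_left_le_one_le)
      ultimately have "cmod (t * d) < \<delta>" "cmod (t * d) \<le> entry_sum D" using elim(1) by linarith+
      moreover from this have "cmod (w + t * d) \<le> R" "cmod w \<le> R"
        using w norm_triangle_ineq[of w "t * d"] entry_sum_nonneg[of D] by (auto simp: R_def)
      ultimately have "dist (poly p z) (poly p w) < \<epsilon>"
        by (intro close) (simp_all add: zwd dist_norm[of "w + t * d"])
      moreover have "cmod (poly p w) \<le> (SUP z\<in>mat_range M. cmod (poly p z))"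
        unfolding w_def by (intro cSUP_upper bdd_above_poly_mat_range[OF M] mat_rangeI[OF M x])
      ultimately show "cmod (poly p z) \<le> (SUP z\<in>mat_range M. cmod (poly p z)) + \<epsilon>"
        using norm_triangle_ineq2[of "poly p z" "poly p w"] by (simp add: dist_norm)
    qed
  qed
qed

section \<open>From cyclic matrices to all matrices\<close>

theorem theorem3p6:
  assumes "\<forall>n>0. \<forall>A\<in>carrier_mat n n. \<forall>p :: complex poly. cyclic_matrix A \<longrightarrow>
     (\<exists>v. cyclic_vector (mat_adjoint A) v \<and>
          E_poly_norm A v p \<le> 2 * (SUP z\<in>E_range A v. cmod (poly p z)))"
  shows "\<forall>n>0. \<forall>M\<in>carrier_mat n n. \<forall>p :: complex poly.
     mat_norm (mat_poly p M) \<le> 2 * (SUP z\<in>mat_range M. cmod (poly p z))"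
proof (intro allI impI ballI)
  fix n :: nat and M :: "complex mat" and p :: "complex poly"
  assume n: "n > 0" and M: "M \<in> carrier_mat n n"
  \<comment> \<open>After the transport neither side depends on \<open>v\<close>, so the existential
    choice in the hypothesis leaves no trace.\<close>
  have cyclic: "mat_norm (mat_poly p A) \<le> 2 * (SUP z\<in>mat_range A. cmod (poly p z))"
    if A: "A \<in> carrier_mat n n" and cyc: "cyclic_matrix A" for A
  proof -
    obtain v where v: "cyclic_vector (mat_adjoint A) v"
      and le: "E_poly_norm A v p \<le> 2 * (SUP z\<in>E_range A v. cmod (poly p z))"
      using assms[rule_format, OF n A cyc] by blast
    have v': "v \<in> carrier_vec n"
      using v mat_adjoint_carrier[OF A] by (simp add: cyclic_vector_def)
    show ?thesis
      using le unfolding E_range_eq_mat_range[OF A v' inj_on_tilde[OF A v]]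
        E_poly_norm_eq_mat_norm[OF A v' inj_on_tilde[OF A v]] .
  qed
  define D where "D = shift_mat n - M"
  define F where "F t = M + t \<cdot>\<^sub>m D" for t
  define s where "s = (SUP z\<in>mat_range M. cmod (poly p z))"
  have D: "D \<in> carrier_mat n n" unfolding D_def by (rule minus_carrier_mat[OF M])
  have F: "F t \<in> carrier_mat n n" for t using M D by (simp add: F_def)
  have lim: "((\<lambda>t. F t $$ (i, j)) \<longlongrightarrow> M $$ (i, j)) (at 0)" if "i < n" "j < n" for i j
  proof -
    have "((\<lambda>t. M $$ (i, j) + t * D $$ (i, j)) \<longlongrightarrow> M $$ (i, j) + 0 * D $$ (i, j)) (at 0)"
      by (intro tendsto_intros)
    then show ?thesis using M D that by (simp add: F_def)
  qed
  show "mat_norm (mat_poly p M) \<le> 2 * s"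
  proof (rule mat_norm_leI[OF mat_poly_carrier[OF M] n])
    fix x assume x: "x \<in> carrier_vec n" "x \<bullet>c x = (1 :: complex)"
    show "sqrt (Re ((mat_poly p M *\<^sub>v x) \<bullet>c (mat_poly p M *\<^sub>v x))) \<le> 2 * s" (is "?N M \<le> _")
    \<comment> \<open>The vector \<open>x\<close> is fixed before \<open>t\<close> varies, so only a
      pointwise limit is needed. The slack \<open>e / 2\<close> in the supremum becomes
      \<open>e\<close> through the factor 2.\<close>
    proof (rule field_le_epsilon)
      fix e :: real assume "e > 0"
      then have "\<forall>\<^sub>F t in at 0. (SUP z\<in>mat_range (F t). cmod (poly p z)) \<le> s + e / 2"
        unfolding F_def s_def by (intro eventually_sup_mat_range_le[OF M D n]) simp
      moreover have "\<forall>\<^sub>F t in at 0. cyclic_matrix (F t)"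
        using eventually_cyclic_perturbation[OF M] by (simp add: F_def D_def)
      ultimately have "\<forall>\<^sub>F t in at 0. ?N (F t) \<le> 2 * s + e"
      proof eventually_elim
        case (elim t)
        have "?N (F t) \<le> mat_norm (mat_poly p (F t))"
          by (rule le_mat_norm[OF mat_poly_carrier[OF F] x])
        also have "\<dots> \<le> 2 * (SUP z\<in>mat_range (F t). cmod (poly p z))"
          by (rule cyclic[OF F elim(2)])
        finally show ?case using elim(1) by simp
      qed
      then show "?N M \<le> 2 * s + e"
        by (intro tendsto_upperbound[OF tendsto_norm_mat_poly_mult_vec[OF F M lim x(1)]]) auto
    qed
  qed
qed

end
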